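(* Let $\beta>1$ and let $T$ be the transport capacity under the protocol model with parameter $\beta$. There is a constant $C$ such that the following holds for all integers $m\ge 1$, all real $t>0$ and all finite sets $X=\{x_1,\dots,x_n\}\subset\mathbb{R}^2$. Let $\{Q_i:1\le i\le m^2\}$ be a partition of the square $[0,1]^2$ into squares with edges parallel to the axes and of side length $m^{-1}$, and let $tQ_i=\{x: x=ty,\ y\in Q_i\}$. Then $$T(X\cap[0,t]^2)\le\sum_{i=1}^{m^2}T(X\cap tQ_i)+Ctm .$$
   Context: Protocol model. Fix $\beta>1$. Nodes are a finite set $\{x_1,\dots,x_n\}\subset\mathbb{R}^2$ and time is divided into discrete slots. In each slot a set of ordered (transmitter, receiver) pairs of nodes is active, each transmitter sending to one receiver. The transmission from $x_i$ to $x_j$ ($i\ne j$) is successful if the ball centered at $x_j$ with radius $\beta|x_i-x_j|$ contains no transmitter active in that slot other than $x_i$. A successful transmission conveys exactly one packet. No cooperative communication techniques are used other than relaying: packets may be stored and forwarded over several hops. The messages of different source-destination pairs are independent. Transport capacity. A rate matrix $(\lambda_{ij})$ is supportable if some scheduling and routing scheme of this type delivers, for every source-destination pair $(i,j)$, packets originating at $x_i$ and destined to $x_j$ at long-run average rate $\lambda_{ij}$ packets per slot (relay hops are not counted separately). The transport capacity is $$T(\{x_1,\dots,x_n\})=\sup\sum_{(i,j)\in\{1,\dots,n\}^2}\lambda_{ij}|x_i-x_j|,$$ the supremum being over all supportable rate matrices. By convention $T$ of a single node (and of the empty set) is $0$. Two cases are considered: $T$ with no constraint on the $\lambda_{ij}$,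 and $T$ with the supremum restricted to supportable rate matrices satisfying Constraint 1: $\max_{j\neq i}\lambda_{ij}>0$ for every $i$. The statement is for either version. *)

theory Defs
  imports "HOL-Analysis.Analysis"
begin

type_synonym node = "real^2"

text \<open>A packet \<open>(i, j, k)\<close> is the \<open>k\<close>-th packet originating at \<open>i\<close> and destined to \<open>j\<close>.
  Packets of different source-destination pairs are different objects, a packet is never
  split or combined with others, and it only ever counts towards the rate of its own pair.\<close>

type_synonym packet = "node \<times> node \<times> nat"

text \<open>The active (transmitter, receiver) pairs and the packets they carry, for each slot.\<close>

type_synonym schedule = "nat \<Rightarrow> (node \<times> node) set"
type_synonym routing = "nat \<Rightarrow> node \<times> node \<Rightarrow> packet"

text \<open>\<open>Domain A\<close> is the set of active transmitters. The ball is the open one: interferers at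
  distance exactly \<open>\<beta> * dist w x\<close> from the receiver are harmless. As the ball contains its
  centre, a node cannot receive while it transmits.\<close>

definition successful :: "real \<Rightarrow> (node \<times> node) set \<Rightarrow> node \<Rightarrow> node \<Rightarrow> bool" where
  "successful \<beta> A w x \<longleftrightarrow> (w, x) \<in> A \<and> Domain A \<inter> ball x (\<beta> * dist w x) \<subseteq> {w}"

text \<open>Packets available at a node at the beginning of a slot: those it originates (sources are
  backlogged) and those received in earlier slots. Forwarding does not delete a packet.\<close>

primrec holds :: "real \<Rightarrow> schedule \<Rightarrow> routing \<Rightarrow> nat \<Rightarrow> node \<Rightarrow> packet set" where
  "holds \<beta> A P 0 x = {(i, j, k). i = x}"
| "holds \<beta> A P (Suc s) x = holds \<beta> A P s x \<union> {P s (w, x) | w. successful \<beta> (A s) w x}"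

definition valid_scheme :: "real \<Rightarrow> node set \<Rightarrow> schedule \<Rightarrow> routing \<Rightarrow> bool" where
  "valid_scheme \<beta> X A P \<longleftrightarrow>
     (\<forall>s. A s \<subseteq> X \<times> X \<and> single_valued (A s) \<and>
          (\<forall>(w, x) \<in> A s. w \<noteq> x \<and> P s (w, x) \<in> holds \<beta> A P s w))"

text \<open>Number of distinct packets from \<open>i\<close> delivered to \<open>j\<close> (\<open>i \<noteq> j\<close>) in the first \<open>N\<close> slots;
  the number of hops, or of copies received, is irrelevant.\<close>

definition delivered :: "real \<Rightarrow> schedule \<Rightarrow> routing \<Rightarrow> node \<Rightarrow> node \<Rightarrow> nat \<Rightarrow> nat" where
  "delivered \<beta> A P i j N = card {k. (i, j, k) \<in> holds \<beta> A P N j}"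

text \<open>The diagonal entries of a rate matrix are left unconstrained; they carry weight
  \<open>dist i i = 0\<close> in the transport capacity.\<close>

definition supportable :: "real \<Rightarrow> node set \<Rightarrow> (node \<Rightarrow> node \<Rightarrow> real) \<Rightarrow> bool" where
  "supportable \<beta> X r \<longleftrightarrow>
     (\<exists>A P. valid_scheme \<beta> X A P \<and>
        (\<forall>i\<in>X. \<forall>j\<in>X. i \<noteq> j \<longrightarrow>
           (\<lambda>N. real (delivered \<beta> A P i j N) / real N) \<longlonglongrightarrow> r i j))"

definition constraint1 :: "node set \<Rightarrow> (node \<Rightarrow> node \<Rightarrow> real) \<Rightarrow> bool" where
  "constraint1 X r \<longleftrightarrow> (\<forall>i\<in>X. Max (r i ` (X - {i})) > 0)"

definition transport_sup :: "node set \<Rightarrow> (node \<Rightarrow> node \<Rightarrow> real) set \<Rightarrow> ereal" where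
  "transport_sup X R =
     (if card X \<le> 1 then 0 else (SUP r\<in>R. ereal (\<Sum>(i, j)\<in>X \<times> X. r i j * dist i j)))"

definition transport_capacity :: "real \<Rightarrow> node set \<Rightarrow> ereal" where
  "transport_capacity \<beta> X = transport_sup X {r. supportable \<beta> X r}"

definition transport_capacity1 :: "real \<Rightarrow> node set \<Rightarrow> ereal" where
  "transport_capacity1 \<beta> X = transport_sup X {r. supportable \<beta> X r \<and> constraint1 X r}"

text \<open>An axis-parallel square of side \<open>s\<close> may contain any part of its boundary, so that the
  closed unit square can be partitioned into squares, in every possible way of allotting the
  common boundary points.\<close>

definition axis_square :: "real \<Rightarrow> (real^2) set \<Rightarrow> bool" where
  "axis_square s Q \<longleftrightarrow> (\<exists>a. box a (a + vec s) \<subseteq> Q \<and> Q \<subseteq> cbox a (a + vec s))"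

definition square_partition :: "nat \<Rightarrow> (nat \<Rightarrow> (real^2) set) \<Rightarrow> bool" where
  "square_partition m Q \<longleftrightarrow>
     (\<forall>i\<in>{1..m^2}. axis_square (1 / real m) (Q i)) \<and>
     disjoint_family_on Q {1..m^2} \<and>
     (\<Union>i\<in>{1..m^2}. Q i) = cbox 0 (vec 1)"

end

theory Submission
  imports Defs
begin

text \<open>
  By the triangle inequality a packet delivered from \<open>i\<close> to \<open>j\<close> accounts for at least \<open>dist i j\<close>
  of the total hop length. Hence the transport capacity is at most the largest total length of
  the successful hops of a single slot; conversely this value is achieved by repeating that slot
  with fresh one-hop packets, and interspersing rare round-robin slots secures constraint 1 at
  a vanishing cost. So it suffices to bound, in one slot, the total length of the hops between
  different squares. Points on two distinct successful hops of lengths \<open>d\<close>, \<open>d'\<close> have distance at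
  least \<open>(\<beta> - 1) * (d + d') / 2\<close>, so the hops meeting a line segment of length \<open>l\<close> have total
  length \<open>O(l + D)\<close>, where \<open>D\<close> bounds their lengths. This is applied to the \<open>4 * m\<^sup>2\<close> edges of the
  squares for crossing hops of length at most \<open>t / m\<close>, and to the lines of a grid of mesh
  \<open>t / (2 * m)\<close> for the longer hops. In this way the position of the squares relative to each other
  is irrelevant, and one need not show that a partition into squares is a grid.
\<close>

section \<open>Upper bound: no scheme beats the best single slot\<close>

definition slot_transport :: "real \<Rightarrow> (node \<times> node) set \<Rightarrow> real" where
  "slot_transport \<beta> A = (\<Sum>(w, x)\<in>{(w, x). successful \<beta> A w x}. dist w x)"

text \<open>Isolates the conditions that \<open>valid_scheme\<close> puts on the active pairs of one
  slot, so that single slots can be treated apart from the routing.\<close>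

definition valid_slot :: "node set \<Rightarrow> (node \<times> node) set \<Rightarrow> bool" where
  "valid_slot X A \<longleftrightarrow> A \<subseteq> X \<times> X \<and> single_valued A \<and> (\<forall>(w, x)\<in>A. w \<noteq> x)"

lemma successful_mem: "successful \<beta> A w x \<Longrightarrow> (w, x) \<in> A"
  by (simp add: successful_def)

lemma successful_subset: "{(w, x). successful \<beta> A w x} \<subseteq> A"
  by (auto simp: successful_def)

lemma finite_successful:
  assumes "finite X" "valid_slot X A"
  shows "finite {(w, x). successful \<beta> A w x}"
  by (rule finite_subset[OF successful_subset])
     (use assms in \<open>auto simp: valid_slot_def intro: finite_subset[OF _ finite_SigmaI]\<close>)

text \<open>A slot brings at most one packet per node of \<open>X\<close> to the receiver. Packets
  originating at \<open>x\<close> itself are excluded because \<open>x\<close> holds infinitely many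
  of them from the start. Finiteness makes the cardinalities in \<open>delivered\<close>
  meaningful.\<close>

lemma finite_holds_delivered:
  assumes "finite X" "valid_scheme \<beta> X A P"
  shows "finite {(i, j, k). i \<noteq> x \<and> (i, j, k) \<in> holds \<beta> A P N x}"
proof (induction N)
  case 0
  have "{(i, j, k). i \<noteq> x \<and> (i, j, k) \<in> holds \<beta> A P 0 x} = {}" by auto
  then show ?case by simp
next
  case (Suc N)
  have "{P N (w, x) | w. successful \<beta> (A N) w x} \<subseteq> (\<lambda>w. P N (w, x)) ` X"
    using assms(2) by (auto simp: valid_scheme_def successful_def)
  then have "finite {P N (w, x) | w. successful \<beta> (A N) w x}"
    using assms(1) finite_surj by blast
  moreover have "{(i, j, k). i \<noteq> x \<and> (i, j, k) \<in> holds \<beta> A P (Suc N) x}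
      \<subseteq> {(i, j, k). i \<noteq> x \<and> (i, j, k) \<in> holds \<beta> A P N x} \<union> {P N (w, x) | w. successful \<beta> (A N) w x}"
    by auto
  ultimately show ?case using Suc by (meson finite_UnI finite_subset)
qed

lemma valid_scheme_slot: "valid_scheme \<beta> X A P \<Longrightarrow> valid_slot X (A s)"
  by (auto simp: valid_scheme_def valid_slot_def)

text \<open>If slot \<open>N\<close> first brings the packet to \<open>x\<close>, the sender
  \<open>w\<close> held it before, and the triangle inequality through \<open>w\<close> adds one
  hop. Summing over all hops that carry the packet, rather than along its route, avoids extracting a
  path.\<close>

lemma dist_le_hops:
  assumes fin: "finite X" and val: "valid_scheme \<beta> X A P"
    and "(i, j, k) \<in> holds \<beta> A P N x"
  shows "dist i x \<le> (\<Sum>s<N. \<Sum>(w, y)\<in>{(w, y). successful \<beta> (A s) w y \<and> P s (w, y) = (i, j, k)}. dist w y)"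
  using assms(3)
proof (induction N arbitrary: x)
  case 0
  then show ?case by simp
next
  case (Suc N)
  let ?E = "\<lambda>s. {(w, y). successful \<beta> (A s) w y \<and> P s (w, y) = (i, j, k)}"
  have finE: "finite (?E s)" for s
    by (rule finite_subset[OF _ finite_successful[OF fin valid_scheme_slot[OF val], of \<beta> s]]) auto
  show ?case
  proof (cases "(i, j, k) \<in> holds \<beta> A P N x")
    case True
    moreover have "0 \<le> (\<Sum>(w, y)\<in>?E N. dist w y)" by (intro sum_nonneg) auto
    ultimately show ?thesis using Suc.IH[of x] by simp
  next
    case False
    then obtain w where w: "successful \<beta> (A N) w x" "P N (w, x) = (i, j, k)"
      using Suc.prems by auto
    have "(i, j, k) \<in> holds \<beta> A P N w"
      using val successful_mem[OF w(1)] w(2) by (fastforce simp: valid_scheme_def)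
    then have 1: "dist i w \<le> (\<Sum>s<N. \<Sum>(w, y)\<in>?E s. dist w y)" by (rule Suc.IH)
    have 2: "dist w x \<le> (\<Sum>(w, y)\<in>?E N. dist w y)"
      using member_le_sum[of "(w, x)" "?E N" "\<lambda>(w, y). dist w y"] finE w by auto
    show ?thesis using 1 2 dist_triangle[of i x w] by simp
  qed
qed

text \<open>Sums \<open>dist_le_hops\<close> over all delivered packets and exchanges the sums, so
  that hops are counted slot by slot.\<close>

lemma delivered_transport_le:
  assumes fin: "finite X" and val: "valid_scheme \<beta> X A P"
  shows "(\<Sum>(i, j)\<in>X \<times> X. real (delivered \<beta> A P i j N) * dist i j)
     \<le> (\<Sum>s<N. slot_transport \<beta> (A s))"
proof -
  \<comment> \<open>Diagonal pairs get no packets: they have weight 0, and their true packet sets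
    are infinite.\<close>
  define K where "K = (\<lambda>(i, j). if i = j then {} else {k. (i, j, k) \<in> holds \<beta> A P N j})"
  define D where "D = (SIGMA e:X \<times> X. K e)"
  define E where "E s = {(w, y). successful \<beta> (A s) w y}" for s
  have finE: "finite (E s)" for s
    unfolding E_def using finite_successful[OF fin valid_scheme_slot[OF val]] .
  have finK: "finite (K e)" for e
  proof -
    obtain i j where e: "e = (i, j)" by force
    have "(\<lambda>k. (i, j, k)) ` K e \<subseteq> {(i, j', k). i \<noteq> j \<and> (i, j', k) \<in> holds \<beta> A P N j}"
      by (auto simp: K_def e split: if_splits)
    then have "finite ((\<lambda>k. (i, j, k)) ` K e)"
      using finite_holds_delivered[OF fin val] by (rule finite_subset)
    then show ?thesis by (rule finite_imageD) (simp add: inj_on_def)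
  qed
  have "(\<Sum>(i, j)\<in>X \<times> X. real (delivered \<beta> A P i j N) * dist i j)
      = (\<Sum>e\<in>X \<times> X. \<Sum>k\<in>K e. dist (fst e) (snd e))"
    by (intro sum.cong) (auto simp: K_def delivered_def)
  also have "\<dots> = (\<Sum>((i, j), k)\<in>D. dist i j)"
    unfolding D_def using fin finK by (subst sum.Sigma) (auto intro!: sum.cong)
  also have "\<dots> \<le> (\<Sum>((i, j), k)\<in>D. \<Sum>s<N. \<Sum>(w, y)\<in>{(w, y). successful \<beta> (A s) w y \<and> P s (w, y) = (i, j, k)}. dist w y)"
    by (intro sum_mono) (auto simp: D_def K_def split: if_splits intro!: dist_le_hops[OF fin val])
  also have "\<dots> = (\<Sum>d\<in>D. \<Sum>s<N. \<Sum>e\<in>E s. if P s e = (fst (fst d), snd (fst d), snd d) then dist (fst e) (snd e) else 0)"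
    using finE by (intro sum.cong) (auto simp: E_def sum.inter_filter[symmetric] split_beta intro!: sum.cong)
  also have "\<dots> = (\<Sum>s<N. \<Sum>e\<in>E s. \<Sum>d\<in>D. if P s e = (fst (fst d), snd (fst d), snd d) then dist (fst e) (snd e) else 0)"
    by (subst sum.swap, rule sum.cong[OF refl], rule sum.swap)
  \<comment> \<open>A hop carries exactly one packet, so at most one \<open>d\<close> in
    \<open>D\<close> contributes to the inner sum.\<close>
  also have "\<dots> \<le> (\<Sum>s<N. \<Sum>e\<in>E s. dist (fst e) (snd e))"
  proof (intro sum_mono)
    fix s e
    let ?p = "P s e"
    let ?d = "((fst ?p, fst (snd ?p)), snd (snd ?p))"
    have "finite D" unfolding D_def using fin finK by auto
    have "(\<Sum>d\<in>D. if ?p = (fst (fst d), snd (fst d), snd d) then dist (fst e) (snd e) else 0)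
       = (\<Sum>d\<in>D. if ?d = d then dist (fst e) (snd e) else 0)"
      by (intro sum.cong) (auto simp: prod_eq_iff)
    then show "(\<Sum>d\<in>D. if ?p = (fst (fst d), snd (fst d), snd d) then dist (fst e) (snd e) else 0) \<le> dist (fst e) (snd e)"
      using \<open>finite D\<close> by simp
  qed
  also have "\<dots> = (\<Sum>s<N. slot_transport \<beta> (A s))"
    by (simp add: slot_transport_def E_def split_beta)
  finally show ?thesis .
qed

text \<open>Divides \<open>delivered_transport_le\<close> by \<open>N\<close> and passes to the
  limit. The bound is extended real so that it may itself be a sum of capacities.\<close>

lemma transport_capacity_le:
  assumes fin: "finite X" and slots: "\<And>A. valid_slot X A \<Longrightarrow> ereal (slot_transport \<beta> A) \<le> b"
  shows "transport_capacity \<beta> X \<le> b"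
proof -
  \<comment> \<open>The empty slot gives nonnegativity of \<open>b\<close>, which settles the
    convention for at most one node and rules out minus infinity.\<close>
  have "valid_slot X {}" by (simp add: valid_slot_def single_valued_def)
  moreover have "slot_transport \<beta> {} = 0" by (simp add: slot_transport_def successful_def)
  ultimately have b0: "0 \<le> b" using slots[of "{}"] by (simp add: zero_ereal_def)
  show ?thesis
  proof (cases b)
    case (real c)
    have "(\<Sum>(i, j)\<in>X \<times> X. r i j * dist i j) \<le> c" if "supportable \<beta> X r" for r
    proof -
      obtain A P where val: "valid_scheme \<beta> X A P"
        and lim: "\<And>i j. i \<in> X \<Longrightarrow> j \<in> X \<Longrightarrow> i \<noteq> j \<Longrightarrow>
           (\<lambda>N. real (delivered \<beta> A P i j N) / real N) \<longlonglongrightarrow> r i j"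
        using \<open>supportable \<beta> X r\<close> unfolding supportable_def by blast
      have "(\<lambda>N. \<Sum>(i, j)\<in>X \<times> X. real (delivered \<beta> A P i j N) / real N * dist i j)
          \<longlonglongrightarrow> (\<Sum>(i, j)\<in>X \<times> X. r i j * dist i j)"
      proof (intro tendsto_sum, clarify)
        fix i j assume "i \<in> X" "j \<in> X"
        then show "(\<lambda>N. real (delivered \<beta> A P i j N) / real N * dist i j) \<longlonglongrightarrow> r i j * dist i j"
          using tendsto_mult_right[OF lim[of i j]] by (cases "i = j") simp_all
      qed
      moreover have "(\<Sum>(i, j)\<in>X \<times> X. real (delivered \<beta> A P i j N) / real N * dist i j) \<le> c"
        if "N \<ge> 1" for N
      proof -
        have "(\<Sum>s<N. slot_transport \<beta> (A s)) \<le> (\<Sum>s<N. c)"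
          using slots[OF valid_scheme_slot[OF val]] real by (intro sum_mono) auto
        then have "(\<Sum>(i, j)\<in>X \<times> X. real (delivered \<beta> A P i j N) * dist i j) \<le> real N * c"
          using delivered_transport_le[OF fin val, of N] by simp
        moreover have "(\<Sum>(i, j)\<in>X \<times> X. real (delivered \<beta> A P i j N) / real N * dist i j)
           = (\<Sum>(i, j)\<in>X \<times> X. real (delivered \<beta> A P i j N) * dist i j) / real N"
          by (simp add: sum_divide_distrib split_beta)
        ultimately show ?thesis using that by (simp add: pos_divide_le_eq mult.commute)
      qed
      ultimately show ?thesis by (intro LIMSEQ_le_const2) auto
    qed
    then show ?thesis
      using b0 real by (auto simp: transport_capacity_def transport_sup_def intro!: SUP_least)
  qed (use b0 in auto)
qed

section \<open>Achievability: repeating slots periodically\<close>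

lemma periodic_count_limit:
  fixes Q :: "nat \<Rightarrow> bool"
  assumes "M > 0"
  shows "(\<lambda>N. real (card {s. s < N \<and> Q (s mod M)}) / real N) \<longlonglongrightarrow> real (card {s. s < M \<and> Q s}) / real M"
proof -
  define c where "c N = card {s. s < N \<and> Q (s mod M)}" for N
  have cM: "card {s. s < M \<and> Q s} = c M"
    unfolding c_def by (intro arg_cong[where f = card]) auto
  have c_le: "c N \<le> N" for N
    unfolding c_def using card_mono[of "{..<N}" "{s. s < N \<and> Q (s mod M)}"] by auto
  have c_add: "c (M + N) = c M + c N" for N
  proof -
    have "{s. s < M + N \<and> Q (s mod M)}
       = {s. s < M \<and> Q (s mod M)} \<union> (\<lambda>s. M + s) ` {s. s < N \<and> Q (s mod M)}" (is "_ = ?A \<union> ?B")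
    proof -
      have "s \<in> ?A \<union> ?B" if "s < M + N" "Q (s mod M)" for s
      proof (cases "s < M")
        case False
        then have "s = M + (s - M)" "s - M < N" "(s - M) mod M = s mod M"
          using that by (auto simp: le_mod_geq)
        then show ?thesis using that by (metis (mono_tags, lifting) UnI2 image_eqI mem_Collect_eq)
      qed (use that in auto)
      then show ?thesis by auto
    qed
    moreover have "card (?A \<union> ?B) = card ?A + card ?B"
      by (intro card_Un_disjoint) auto
    moreover have "card ?B = card {s. s < N \<and> Q (s mod M)}"
      by (intro card_image) (auto simp: inj_on_def)
    ultimately show ?thesis by (simp add: c_def)
  qed
  \<comment> \<open>Adding \<open>M\<close> to \<open>N\<close> changes both products by
    \<open>M * c M\<close>, so their difference has period \<open>M\<close>. On the first period
    both lie between 0 and \<open>M * M\<close>.\<close>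
  have bound: "\<bar>real M * real (c N) - real N * real (c M)\<bar> \<le> real M * real M" for N
  proof (induction N rule: less_induct)
    case (less N)
    show ?case
    proof (cases "N < M")
      case True
      have "c N \<le> M" "c M \<le> M" "N \<le> M" using c_le[of N] c_le[of M] True by auto
      then have "M * c N \<le> M * M" "N * c M \<le> M * M" by (auto intro: mult_mono)
      then have "real (M * c N) \<le> real (M * M)" "real (N * c M) \<le> real (M * M)"
        using of_nat_le_iff by blast+
      moreover have "0 \<le> real (M * c N)" "0 \<le> real (N * c M)" by auto
      ultimately show ?thesis unfolding of_nat_mult by linarith
    next
      case False
      then obtain N' where N': "N = M + N'" using le_iff_add not_less by metis
      then show ?thesis using less.IH[of N'] assms c_add[of N'] by (simp add: algebra_simps)
    qed
  qed
  have "(\<lambda>N. real (c N) / real N - real (c M) / real M) \<longlonglongrightarrow> 0"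
  proof (rule Lim_null_comparison)
    show "\<forall>\<^sub>F N in sequentially. norm (real (c N) / real N - real (c M) / real M) \<le> real M / real N"
      using eventually_gt_at_top[of 0]
    proof eventually_elim
      case (elim N)
      have "real (c N) / real N - real (c M) / real M
         = (real M * real (c N) - real N * real (c M)) / (real M * real N)"
        using elim assms by (simp add: field_simps)
      then have "\<bar>real (c N) / real N - real (c M) / real M\<bar> \<le> real M * real M / (real M * real N)"
        using divide_right_mono[OF bound[of N], of "real M * real N"] by simp
      moreover have "real M * real M / (real M * real N) = real M / real N" using assms by simp
      ultimately show ?case by simp
    qed
    show "(\<lambda>N. real M / real N) \<longlonglongrightarrow> 0" by (rule lim_const_over_n)
  qed
  then show ?thesis unfolding cM by (simp add: LIM_zero_iff c_def)
qed

lemma holds_eq: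
  "holds \<beta> A P N x = {(i, j, k). i = x} \<union> {P s (w, x) | s w. s < N \<and> successful \<beta> (A s) w x}"
  by (induction N) (auto simp: less_Suc_eq)

text \<open>The slots \<open>S 0\<close>, ..., \<open>S (M - 1)\<close> are repeated forever, every
  hop carrying a packet of its own transmitter straight to the destination. The rate of a pair is
  then its frequency of success.\<close>

lemma supportable_one_hop:
  assumes M: "M > 0" and val: "\<And>q. q < M \<Longrightarrow> valid_slot X (S q)"
  shows "supportable \<beta> X (\<lambda>i j. real (card {q. q < M \<and> successful \<beta> (S q) i j}) / real M)"
proof -
  define A where "A s = S (s mod M)" for s
  \<comment> \<open>Numbering packets by the slot makes every transmission fresh, so deliveries and
    successes are equinumerous.\<close>
  define P :: routing where "P s = (\<lambda>(w, x). (w, x, s))" for s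
  have "valid_scheme \<beta> X A P"
    unfolding valid_scheme_def
  proof
    fix s
    have "valid_slot X (A s)" unfolding A_def using M by (intro val) simp
    then show "A s \<subseteq> X \<times> X \<and> single_valued (A s) \<and>
        (\<forall>(w, x)\<in>A s. w \<noteq> x \<and> P s (w, x) \<in> holds \<beta> A P s w)"
      by (auto simp: valid_slot_def P_def holds_eq)
  qed
  moreover have "delivered \<beta> A P i j N = card {s. s < N \<and> successful \<beta> (S (s mod M)) i j}"
    if "i \<noteq> j" for i j N
    using that by (auto simp: delivered_def holds_eq A_def P_def intro!: arg_cong[where f = card])
  ultimately show ?thesis
    unfolding supportable_def
    using periodic_count_limit[OF M, of "\<lambda>q. successful \<beta> (S q) i j" for i j]
    by (intro exI[of _ A] exI[of _ P] conjI ballI impI) simp_all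
qed

text \<open>A period consists of \<open>n\<close> copies of \<open>A\<close> and one extra slot for
  each of the \<open>c\<close> nodes. The extra slots secure constraint 1, and their share
  \<open>c / (n + c)\<close> vanishes as \<open>n\<close> grows.\<close>

lemma slot_transport_le_capacity1:
  assumes fin: "finite X" and val: "valid_slot X A"
  shows "ereal (slot_transport \<beta> A) \<le> transport_capacity1 \<beta> X"
proof (cases "card X \<le> 1")
  case True
  then have "\<forall>w\<in>X. \<forall>x\<in>X. w = x" using card_le_Suc0_iff_eq[OF fin] by simp
  then have "A = {}" using val unfolding valid_slot_def by blast
  then show ?thesis
    using True by (simp add: slot_transport_def transport_capacity1_def transport_sup_def successful_def)
next
  case False
  define c where "c = card X"
  obtain h where h: "bij_betw h {0..<c} X"
    unfolding c_def using ex_bij_betw_nat_finite[OF fin] by blast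
  have "\<exists>y\<in>X. y \<noteq> x" for x
    using False fin by (metis card_le_Suc0_iff_eq One_nat_def)
  then obtain f where f: "\<And>x. f x \<in> X \<and> f x \<noteq> x" by metis
  have bound: "ereal (real n / real (n + c) * slot_transport \<beta> A) \<le> transport_capacity1 \<beta> X" for n
  proof -
    define S where "S q = (if q < n then A else {(h (q - n), f (h (q - n)))})" for q
    define r where "r i j = real (card {q. q < n + c \<and> successful \<beta> (S q) i j}) / real (n + c)" for i j
    have M: "n + c > 0" using False c_def by simp
    have "h q \<in> X" if "q < c" for q using h that by (auto simp: bij_betw_def)
    then have "valid_slot X (S q)" if "q < n + c" for q
      using val f[of "h (q - n)"] that by (auto simp: S_def valid_slot_def single_valued_def)
    then have supp: "supportable \<beta> X r"
      unfolding r_def using supportable_one_hop[OF M] by blast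
    have pos: "0 < r i (f i)" if i: "i \<in> X" for i
    proof -
      obtain q where q: "q < c" "h q = i" using h i by (force simp: bij_betw_def)
      \<comment> \<open>In slot \<open>n + q\<close> the node \<open>i\<close> is the only
        transmitter, so nothing interferes.\<close>
      have "successful \<beta> (S (n + q)) i (f i)" using q by (auto simp: S_def successful_def)
      then have "n + q \<in> {q. q < n + c \<and> successful \<beta> (S q) i (f i)}" using q by auto
      then have "{q. q < n + c \<and> successful \<beta> (S q) i (f i)} \<noteq> {}" by blast
      then have "card {q. q < n + c \<and> successful \<beta> (S q) i (f i)} > 0"
        by (simp add: card_gt_0_iff)
      then show ?thesis using M unfolding r_def by (intro divide_pos_pos) linarith+
    qed
    have "constraint1 X r"
      unfolding constraint1_def
    proof
      fix i assume i: "i \<in> X"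
      have "r i (f i) \<le> Max (r i ` (X - {i}))" using f[of i] fin by (intro Max_ge) auto
      then show "0 < Max (r i ` (X - {i}))" using pos[OF i] by simp
    qed
    then have "ereal (\<Sum>(i, j)\<in>X \<times> X. r i j * dist i j) \<le> transport_capacity1 \<beta> X"
      using supp False by (auto simp: transport_capacity1_def transport_sup_def intro!: SUP_upper)
    moreover have "real n / real (n + c) * slot_transport \<beta> A \<le> (\<Sum>(i, j)\<in>X \<times> X. r i j * dist i j)"
    proof -
      have "real n / real (n + c) * slot_transport \<beta> A
         = (\<Sum>(i, j)\<in>{(w, x). successful \<beta> A w x}. real n / real (n + c) * dist i j)"
        by (simp add: slot_transport_def sum_distrib_left split_beta)
      also have "\<dots> \<le> (\<Sum>(i, j)\<in>{(w, x). successful \<beta> A w x}. r i j * dist i j)"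
      proof (intro sum_mono, clarify)
        fix i j assume "successful \<beta> A i j"
        then have "{..<n} \<subseteq> {q. q < n + c \<and> successful \<beta> (S q) i j}" by (auto simp: S_def)
        then have "n \<le> card {q. q < n + c \<and> successful \<beta> (S q) i j}"
          using card_mono[of "{q. q < n + c \<and> successful \<beta> (S q) i j}" "{..<n}"] by auto
        then have "real n / real (n + c) \<le> r i j" unfolding r_def by (intro divide_right_mono) auto
        then show "real n / real (n + c) * dist i j \<le> r i j * dist i j" by (intro mult_right_mono) auto
      qed
      also have "\<dots> \<le> (\<Sum>(i, j)\<in>X \<times> X. r i j * dist i j)"
        using successful_subset[of \<beta> A] val fin
        by (intro sum_mono2) (auto simp: valid_slot_def r_def)
      finally show ?thesis .
    qed
    ultimately show ?thesis by (meson ereal_less_eq(3) order_trans)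
  qed
  have "(\<lambda>n. 1 - real c / real (n + c)) \<longlonglongrightarrow> 1 - 0"
    by (intro tendsto_diff tendsto_const LIMSEQ_ignore_initial_segment lim_const_over_n)
  moreover have "1 - real c / real (n + c) = real n / real (n + c)" for n
    using False by (simp add: c_def field_simps)
  ultimately have "(\<lambda>n. real n / real (n + c)) \<longlonglongrightarrow> 1" by simp
  then have "(\<lambda>n. real n / real (n + c) * slot_transport \<beta> A) \<longlonglongrightarrow> 1 * slot_transport \<beta> A"
    by (rule tendsto_mult_right)
  then have "(\<lambda>n. ereal (real n / real (n + c) * slot_transport \<beta> A)) \<longlonglongrightarrow> ereal (slot_transport \<beta> A)"
    by simp
  then show ?thesis by (rule LIMSEQ_le_const2) (use bound in blast)
qed

section \<open>Packing of successful hops along a line\<close>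

text \<open>The separation hypothesis says that the intervals of radius \<open>c * d e\<close> around the points
  \<open>f e\<close> do not overlap.\<close>

lemma interval_packing:
  fixes f d :: "'a \<Rightarrow> real"
  assumes "finite E"
    and "\<And>e. e \<in> E \<Longrightarrow> u \<le> f e \<and> f e \<le> u + l"
    and "\<And>e. e \<in> E \<Longrightarrow> d e \<le> D"
    and "\<And>e e'. e \<in> E \<Longrightarrow> e' \<in> E \<Longrightarrow> e \<noteq> e' \<Longrightarrow> c * (d e + d e') \<le> \<bar>f e - f e'\<bar>"
    and "c \<ge> 0" "l \<ge> 0" "D \<ge> 0"
  shows "2 * c * (\<Sum>e\<in>E. d e) \<le> l + 2 * c * D"
proof -
  \<comment> \<open>The right end \<open>v\<close> is left free for the induction: the right-hand
    side is the length of the interval from \<open>u - c * D\<close> to \<open>v\<close>, which has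
    to accommodate the intervals of \<open>S\<close>.\<close>
  have "2 * c * (\<Sum>e\<in>S. d e) \<le> v - u + c * D"
    if "S \<subseteq> E" "u - c * D \<le> v" "\<And>e. e \<in> S \<Longrightarrow> f e + c * d e \<le> v" for S v
    using finite_subset[OF that(1) assms(1)] that
  proof (induction S arbitrary: v rule: finite_ranking_induct[where f = f])
    case empty
    then show ?case by simp
  next
    case (insert x S)
    show ?case
    proof (cases "x \<in> S")
      case True
      then show ?thesis using insert.prems by (simp add: insert_absorb insert.IH)
    next
      case False
      have x: "x \<in> E" "u \<le> f x" "c * d x \<le> c * D"
        using insert.prems assms by (auto intro: mult_left_mono)
      \<comment> \<open>As \<open>f x\<close> is maximal, separation puts the other intervals to the
        left of that of \<open>x\<close>, and \<open>f x - c * d x\<close> becomes the new right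
        end.\<close>
      have "f e + c * d e \<le> f x - c * d x" if "e \<in> S" for e
      proof -
        have "c * (d x + d e) \<le> \<bar>f x - f e\<bar>" "f e \<le> f x"
          using assms(4)[of x e] that insert.prems insert.hyps False by auto
        then show ?thesis by (simp add: algebra_simps)
      qed
      then have "2 * c * (\<Sum>e\<in>S. d e) \<le> f x - c * d x - u + c * D"
        using insert.prems x by (intro insert.IH) auto
      moreover have "f x + c * d x \<le> v" using insert.prems by auto
      ultimately show ?thesis using insert.hyps False by (simp add: algebra_simps)
    qed
  qed
  from this[of E "u + l + c * D"] show ?thesis
    using assms(2,3,5-7) by (fastforce intro: add_mono mult_left_mono simp: algebra_simps)
qed

text \<open>Each receiver is far from the other hop's transmitter. Going from receiver to
  transmitter through \<open>p\<close> and \<open>p'\<close> and adding both inequalities, the four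
  partial lengths sum to the two hop lengths, which leaves the factor
  \<open>\<beta> - 1\<close>.\<close>

lemma successful_separation:
  assumes "single_valued A" "successful \<beta> A w x" "successful \<beta> A w' x'" "(w, x) \<noteq> (w', x')"
    and "p \<in> closed_segment w x" "p' \<in> closed_segment w' x'"
  shows "(\<beta> - 1) * (dist w x + dist w' x') \<le> 2 * dist p p'"
proof -
  \<comment> \<open>A transmitter has one receiver per slot, so distinct hops have distinct
    transmitters and each counts as an interferer of the other.\<close>
  have ne: "w \<noteq> w'" using assms(1-4) by (auto simp: successful_def dest: single_valuedD)
  have "\<beta> * dist w x \<le> dist x w'" "\<beta> * dist w' x' \<le> dist x' w"
    using assms(2,3) ne by (force simp: successful_def)+
  moreover have "dist w x = dist w p + dist p x" "dist w' x' = dist w' p' + dist p' x'"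
    using assms(5,6) by (auto simp: between_mem_segment[symmetric] between)
  moreover have "dist x w' \<le> dist p x + dist p p' + dist w' p'"
    "dist x' w \<le> dist p' x' + dist p p' + dist w p"
    using dist_triangle[of x w' p] dist_triangle[of p w' p'] dist_triangle[of x' w p']
      dist_triangle[of p' w p] by (simp_all add: dist_commute)
  ultimately show ?thesis by (simp add: algebra_simps)
qed

text \<open>One crossing point is chosen on each hop. These points differ only in coordinate
  \<open>k'\<close>, so their separation in the plane is a separation on the line, and
  \<open>interval_packing\<close> applies with constant \<open>(\<beta> - 1) / 2\<close>.\<close>

lemma line_crossing_le:
  fixes k k' :: 2
  assumes \<beta>: "\<beta> > 1" and A: "single_valued A" and k: "k \<noteq> k'"
    and fin: "finite E" and E: "E \<subseteq> {(w, x). successful \<beta> A w x}"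
    and cross: "\<And>w x. (w, x) \<in> E \<Longrightarrow> \<exists>p\<in>closed_segment w x. p $ k = v \<and> u \<le> p $ k' \<and> p $ k' \<le> u + l"
    and D: "\<And>w x. (w, x) \<in> E \<Longrightarrow> dist w x \<le> D" and "l \<ge> 0" "D \<ge> 0"
  shows "(\<Sum>(w, x)\<in>E. dist w x) \<le> (l + (\<beta> - 1) * D) / (\<beta> - 1)"
proof -
  obtain p where p: "\<And>w x. (w, x) \<in> E \<Longrightarrow>
      p (w, x) \<in> closed_segment w x \<and> p (w, x) $ k = v \<and> u \<le> p (w, x) $ k' \<and> p (w, x) $ k' \<le> u + l"
    using bchoice[of E "\<lambda>e q. q \<in> closed_segment (fst e) (snd e) \<and> q $ k = v \<and> u \<le> q $ k' \<and> q $ k' \<le> u + l"]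
      cross by fastforce
  have UN: "(UNIV :: 2 set) = {k, k'}" using k exhaust_2 by (metis (mono_tags) UNIV_eq_I insert_iff)
  have "2 * ((\<beta> - 1) / 2) * (\<Sum>e\<in>E. dist (fst e) (snd e)) \<le> l + 2 * ((\<beta> - 1) / 2) * D"
  proof (rule interval_packing[where f = "\<lambda>e. p e $ k'" and u = u])
    fix e e' assume ee: "e \<in> E" "e' \<in> E" "e \<noteq> e'"
    obtain w x w' x' where [simp]: "e = (w, x)" "e' = (w', x')" by force
    have "(\<beta> - 1) * (dist w x + dist w' x') \<le> 2 * dist (p e) (p e')"
      using ee E p by (intro successful_separation[OF A]) auto
    also have "dist (p e) (p e') \<le> (\<Sum>i\<in>UNIV. \<bar>(p e - p e') $ i\<bar>)"
      unfolding dist_norm by (rule norm_le_l1_cart)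
    also have "\<dots> = \<bar>p e $ k' - p e' $ k'\<bar>"
      using p ee k by (simp add: UN)
    finally show "(\<beta> - 1) / 2 * (dist (fst e) (snd e) + dist (fst e') (snd e')) \<le> \<bar>p e $ k' - p e' $ k'\<bar>"
      by simp
  qed (use assms p in auto)
  then show ?thesis using \<beta> by (simp add: field_simps split_beta)
qed

section \<open>Hops between different squares\<close>

lemma sum_le_sum_cover:
  fixes f :: "'a \<Rightarrow> real"
  assumes "finite I" "\<And>i. i \<in> I \<Longrightarrow> finite (F i)" "finite E" "E \<subseteq> (\<Union>i\<in>I. F i)"
    and "\<And>i e. i \<in> I \<Longrightarrow> e \<in> F i \<Longrightarrow> 0 \<le> f e"
  shows "sum f E \<le> (\<Sum>i\<in>I. sum f (F i))"
proof -
  have "sum f E \<le> (\<Sum>(i, e)\<in>(SIGMA i:I. F i). f e)"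
  proof (rule sum_le_included[where i = snd])
    show "\<forall>e\<in>E. \<exists>y\<in>SIGMA i:I. F i. snd y = e \<and> f e \<le> (case y of (i, e) \<Rightarrow> f e)"
      using assms(4) by force
  qed (use assms in auto)
  then show ?thesis using assms(1,2) by (simp add: sum.Sigma)
qed

lemma sum_le_card_cover:
  fixes f :: "'a \<Rightarrow> real"
  assumes "finite I" "finite E" "E \<subseteq> (\<Union>i\<in>I. F i)"
    and "\<And>e. e \<in> E \<Longrightarrow> 0 \<le> f e"
    and "\<And>i. i \<in> I \<Longrightarrow> sum f (E \<inter> F i) \<le> b"
  shows "sum f E \<le> real (card I) * b"
proof -
  have "sum f E \<le> (\<Sum>i\<in>I. sum f (E \<inter> F i))"
    using assms by (intro sum_le_sum_cover) auto
  also have "\<dots> \<le> (\<Sum>i\<in>I. b)" using assms(5) by (rule sum_mono)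
  finally show ?thesis by simp
qed

lemma long_hops_le:
  assumes \<beta>: "\<beta> > 1" and m: "m \<ge> 1" and t: "t > 0" and A: "single_valued A"
    and fin: "finite E" and E: "E \<subseteq> {(w, x). successful \<beta> A w x}"
    and box: "E \<subseteq> cbox 0 (vec t) \<times> cbox 0 (vec t)"
    and long: "\<And>w x. (w, x) \<in> E \<Longrightarrow> t / real m < dist w x"
  shows "(\<Sum>(w, x)\<in>E. dist w x) \<le> 6 * (2 * \<beta> - 1) / (\<beta> - 1) * t * real m"
proof -
  \<comment> \<open>Half of \<open>t / m\<close>: a hop longer than \<open>2 * h\<close> is only
    known to exceed \<open>h\<close> in one of its two coordinates.\<close>
  define h where "h = t / (2 * real m)"
  have h: "h > 0" "t = 2 * real m * h" using m t by (auto simp: h_def)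
  have bnd: "0 \<le> p $ i \<and> p $ i \<le> t" if "p \<in> closed_segment w x" "(w, x) \<in> E" for p w x and i :: 2
  proof -
    have "closed_segment w x \<subseteq> cbox 0 (vec t)"
      using that box by (intro closed_segment_subset) auto
    then show ?thesis using that by (force simp: mem_box_cart)
  qed
  define F where "F = (\<lambda>(n::nat, k::2). {(w, x). \<exists>p\<in>closed_segment w x. p $ k = real n * h})"
  \<comment> \<open>The bound of \<open>line_crossing_le\<close> for a grid line of length
    \<open>t\<close>, hop lengths being at most \<open>2 * t\<close> in the square.\<close>
  let ?b = "(t + (\<beta> - 1) * (2 * t)) / (\<beta> - 1)"
  have dist_l1: "dist w x \<le> \<bar>w $ 1 - x $ 1\<bar> + \<bar>w $ 2 - x $ 2\<bar>" for w x :: "real^2"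
    using norm_le_l1_cart[of "w - x"] by (simp add: dist_norm sum_2)
  have "(\<Sum>(w, x)\<in>E. dist w x) \<le> real (card ({..2 * m} \<times> (UNIV :: 2 set))) * ?b"
  proof (rule sum_le_card_cover[OF _ fin, where F = F])
    show "E \<subseteq> (\<Union>i\<in>{..2 * m} \<times> UNIV. F i)"
    proof clarify
      fix w x assume wx: "(w, x) \<in> E"
      have "2 * h < dist w x" using long[OF wx] m by (simp add: h_def)
      then have "h < \<bar>w $ 1 - x $ 1\<bar> \<or> h < \<bar>w $ 2 - x $ 2\<bar>" using dist_l1[of w x] by linarith
      then obtain k :: 2 where k: "h < \<bar>w $ k - x $ k\<bar>" by blast
      define lo hi where "lo = min (w $ k) (x $ k)" and "hi = max (w $ k) (x $ k)"
      have lohi: "0 \<le> lo" "lo + h < hi" "hi \<le> t"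
        using k bnd[OF ends_in_segment(1) wx, of k] bnd[OF ends_in_segment(2) wx, of k]
        by (auto simp: lo_def hi_def)
      \<comment> \<open>Index of the first grid line at or beyond \<open>lo\<close>. It is less than
        one mesh away, hence before \<open>hi\<close>.\<close>
      define n where "n = nat \<lceil>lo / h\<rceil>"
      have "real n = of_int \<lceil>lo / h\<rceil>" using lohi h by (simp add: n_def)
      then have "lo / h \<le> real n" "real n < lo / h + 1" by linarith+
      then have n: "lo \<le> real n * h" "real n * h < lo + h" using h(1) by (simp_all add: field_simps)
      have "real n * h \<in> closed_segment (w $ k) (x $ k)"
        using n lohi by (auto simp: lo_def hi_def closed_segment_eq_real_ivl)
      moreover have "(\<lambda>p. p $ k) ` closed_segment w x = closed_segment (w $ k) (x $ k)"
        by (rule closed_segment_linear_image[symmetric]) (simp add: linear_iff)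
      ultimately obtain p where "p \<in> closed_segment w x" "p $ k = real n * h" by (metis imageE)
      then have "(w, x) \<in> F (n, k)" by (auto simp: F_def)
      moreover have "real n * h < real (2 * m) * h" using n lohi h(2) unfolding of_nat_mult by linarith
      then have "n \<le> 2 * m" using h(1) by (simp only: mult_less_cancel_right_pos of_nat_less_iff less_imp_le)
      ultimately show "(w, x) \<in> (\<Union>i\<in>{..2 * m} \<times> UNIV. F i)" by blast
    qed
  next
    fix i assume "i \<in> {..2 * m} \<times> (UNIV :: 2 set)"
    obtain n k where i: "i = (n, k :: 2)" by force
    \<comment> \<open>In the index type \<open>2\<close>, \<open>k + 1\<close> is the other
      coordinate.\<close>
    have "k + 1 \<noteq> k" by simp
    show "(\<Sum>(w, x)\<in>E \<inter> F i. dist w x) \<le> ?b"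
    proof (rule line_crossing_le[OF \<beta> A, of k "k + 1" _ "real n * h" 0])
      fix w x assume wx: "(w, x) \<in> E \<inter> F i"
      then show "\<exists>p\<in>closed_segment w x. p $ k = real n * h \<and> 0 \<le> p $ (k + 1) \<and> p $ (k + 1) \<le> 0 + t"
        using bnd[of _ w x] by (fastforce simp: F_def i)
      have "\<bar>w $ j - x $ j\<bar> \<le> t" for j
        using wx bnd[OF ends_in_segment(1), of w x j] bnd[OF ends_in_segment(2), of w x j] by auto
      from add_mono[OF this[of 1] this[of 2]] show "dist w x \<le> 2 * t"
        using dist_l1[of w x] by linarith
    qed (use fin E t in auto)
  qed auto
  also have "\<dots> = 2 * (2 * real m + 1) * ?b" by (simp add: card_cartesian_product)
  \<comment> \<open>The grid has \<open>2 * m + 1\<close> lines in each direction, and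
    \<open>2 * m + 1 \<le> 3 * m\<close>.\<close>
  also have "\<dots> \<le> 6 * real m * ?b"
    using m \<beta> t by (intro mult_right_mono divide_nonneg_pos add_nonneg_nonneg mult_nonneg_nonneg) auto
  also have "\<dots> = 6 * (2 * \<beta> - 1) / (\<beta> - 1) * t * real m"
    by (simp add: field_simps)
  finally show ?thesis .
qed

lemma axis_square_scaled:
  fixes t :: real
  assumes "t > 0" "axis_square s Q"
  obtains a where "box a (a + vec (t * s)) \<subseteq> (\<lambda>y. t *\<^sub>R y) ` Q"
    "(\<lambda>y. t *\<^sub>R y) ` Q \<subseteq> cbox a (a + vec (t * s))"
proof -
  obtain a where a: "box a (a + vec s) \<subseteq> Q" "Q \<subseteq> cbox a (a + vec s)"
    using assms(2) by (auto simp: axis_square_def)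
  have "box (t *\<^sub>R a) (t *\<^sub>R a + vec (t * s)) \<subseteq> (\<lambda>y. t *\<^sub>R y) ` box a (a + vec s)"
  proof
    fix y assume "y \<in> box (t *\<^sub>R a) (t *\<^sub>R a + vec (t * s))"
    then have "(1 / t) *\<^sub>R y \<in> box a (a + vec s)"
      using assms(1) by (auto simp: mem_box_cart field_simps)
    then show "y \<in> (\<lambda>y. t *\<^sub>R y) ` box a (a + vec s)"
      using assms(1) by (intro image_eqI[of _ _ "(1 / t) *\<^sub>R y"]) auto
  qed
  moreover have "(\<lambda>y. t *\<^sub>R y) ` cbox a (a + vec s) \<subseteq> cbox (t *\<^sub>R a) (t *\<^sub>R a + vec (t * s))"
    using assms(1) by (auto simp: mem_box_cart algebra_simps[symmetric] simp flip: distrib_left)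
  ultimately show ?thesis using a by (intro that[of "t *\<^sub>R a"]) blast+
qed

text \<open>A hop from a closed square to a point outside its interior meets one of the four edges.
  Each edge has length \<open>L\<close>, and so does the bound on the hops, whence
  \<open>L + (\<beta> - 1) * L = \<beta> * L\<close>.\<close>

lemma short_hops_le:
  assumes \<beta>: "\<beta> > 1" and A: "single_valued A" and L: "L \<ge> 0"
    and fin: "finite E" and E: "E \<subseteq> {(w, x). successful \<beta> A w x}" and I: "finite I"
    and sq: "\<And>w x. (w, x) \<in> E \<Longrightarrow> \<exists>i\<in>I. w \<in> cbox (a i) (a i + vec L) \<and> x \<notin> box (a i) (a i + vec L)"
    and short: "\<And>w x. (w, x) \<in> E \<Longrightarrow> dist w x \<le> L"
  shows "(\<Sum>(w, x)\<in>E. dist w x) \<le> 4 * real (card I) * (\<beta> * L / (\<beta> - 1))"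
proof -
  \<comment> \<open>Hops meeting one edge of square \<open>i\<close>: \<open>k\<close> is the
    coordinate constant along the edge, and \<open>b\<close> selects the lower or the upper
    edge.\<close>
  define F where "F = (\<lambda>(i, k::2, b::bool). {(w, x). \<exists>p\<in>closed_segment w x.
      p $ k = a i $ k + of_bool b * L \<and> a i $ (k + 1) \<le> p $ (k + 1) \<and> p $ (k + 1) \<le> a i $ (k + 1) + L})"
  have "(\<Sum>(w, x)\<in>E. dist w x)
     \<le> real (card (I \<times> (UNIV :: 2 set) \<times> (UNIV :: bool set))) * ((L + (\<beta> - 1) * L) / (\<beta> - 1))"
  proof (rule sum_le_card_cover[OF _ fin, where F = F])
    show "E \<subseteq> (\<Union>i\<in>I \<times> UNIV \<times> UNIV. F i)"
    proof clarify
      fix w x assume wx: "(w, x) \<in> E"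
      obtain i where i: "i \<in> I" "w \<in> cbox (a i) (a i + vec L)" "x \<notin> box (a i) (a i + vec L)"
        using sq[OF wx] by blast
      \<comment> \<open>If \<open>x\<close> lies in the closed square, it is itself a boundary
        point; otherwise connectedness of the segment gives one.\<close>
      have "\<exists>p\<in>closed_segment w x. p \<in> cbox (a i) (a i + vec L) - box (a i) (a i + vec L)"
      proof (cases "x \<in> cbox (a i) (a i + vec L)")
        case False
        then have "closed_segment w x \<inter> frontier (cbox (a i) (a i + vec L)) \<noteq> {}"
          using i by (intro connected_Int_frontier connected_segment) auto
        then show ?thesis by (auto simp: frontier_cbox)
      qed (use i in auto)
      then obtain p where p: "p \<in> closed_segment w x" "p \<in> cbox (a i) (a i + vec L)"
        "p \<notin> box (a i) (a i + vec L)" by blast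
      have in_cbox: "a i $ j \<le> p $ j \<and> p $ j \<le> a i $ j + L" for j
        using p(2) by (auto simp: mem_box_cart)
      obtain k where "\<not> (a i $ k < p $ k \<and> p $ k < a i $ k + L)"
        using p(3) by (auto simp: mem_box_cart)
      then have "p $ k = a i $ k \<or> p $ k = a i $ k + L"
        using in_cbox[of k] by linarith
      then obtain b where "p $ k = a i $ k + of_bool b * L"
        by (metis add.right_neutral mult_1 mult_zero_left of_bool_eq)
      then have "(w, x) \<in> F (i, k, b)"
        using p(1) in_cbox[of "k + 1"] unfolding F_def by blast
      then show "(w, x) \<in> (\<Union>i\<in>I \<times> UNIV \<times> UNIV. F i)" using i(1) by blast
    qed
  next
    fix e assume "e \<in> I \<times> (UNIV :: 2 set) \<times> (UNIV :: bool set)"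
    obtain i k b where e: "e = (i, k :: 2, b :: bool)" by (metis prod.exhaust)
    show "(\<Sum>(w, x)\<in>E \<inter> F e. dist w x) \<le> (L + (\<beta> - 1) * L) / (\<beta> - 1)"
      by (rule line_crossing_le[OF \<beta> A, of k "k + 1" _ "a i $ k + of_bool b * L" "a i $ (k + 1)"])
         (use fin E short L in \<open>auto simp: F_def e\<close>)
  qed (use I in auto)
  also have "real (card (I \<times> (UNIV :: 2 set) \<times> (UNIV :: bool set))) = 4 * real (card I)"
    by (simp add: card_cartesian_product)
  also have "(L + (\<beta> - 1) * L) / (\<beta> - 1) = \<beta> * L / (\<beta> - 1)" by (simp add: algebra_simps)
  finally show ?thesis .
qed

lemma crossing_le:
  assumes \<beta>: "\<beta> > 1" and m: "m \<ge> 1" and t: "t > 0" and Q: "square_partition m Q"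
    and A: "single_valued A" and fin: "finite E" and E: "E \<subseteq> {(w, x). successful \<beta> A w x}"
    and cross: "\<And>w x. (w, x) \<in> E \<Longrightarrow> \<exists>i\<in>{1..m^2}. \<exists>j\<in>{1..m^2}. i \<noteq> j \<and>
       w \<in> (\<lambda>y. t *\<^sub>R y) ` Q i \<and> x \<in> (\<lambda>y. t *\<^sub>R y) ` Q j"
    and box: "E \<subseteq> cbox 0 (vec t) \<times> cbox 0 (vec t)"
  shows "(\<Sum>(w, x)\<in>E. dist w x) \<le> 16 * \<beta> / (\<beta> - 1) * t * real m"
proof -
  define L where "L = t / real m"
  let ?S = "\<lambda>i. (\<lambda>y. t *\<^sub>R y) ` Q i"
  have "\<exists>a. box a (a + vec L) \<subseteq> ?S i \<and> ?S i \<subseteq> cbox a (a + vec L)" if "i \<in> {1..m^2}" for i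
  proof -
    have "axis_square (1 / real m) (Q i)" using Q that by (simp add: square_partition_def)
    from axis_square_scaled[OF t this] show ?thesis unfolding L_def by (metis mult.right_neutral times_divide_eq_right)
  qed
  then obtain a where a: "\<And>i. i \<in> {1..m^2} \<Longrightarrow> box (a i) (a i + vec L) \<subseteq> ?S i \<and> ?S i \<subseteq> cbox (a i) (a i + vec L)"
    by metis
  have disj: "?S i \<inter> ?S j = {}" if "i \<in> {1..m^2}" "j \<in> {1..m^2}" "i \<noteq> j" for i j
  proof -
    have "Q i \<inter> Q j = {}" using Q that by (auto simp: square_partition_def disjoint_family_on_def)
    then show ?thesis using t by auto
  qed
  \<comment> \<open>Split at the side length: the short hops contribute 4 and the long ones at most
    12 to the constant 16.\<close>
  let ?E1 = "{(w, x). (w, x) \<in> E \<and> dist w x \<le> L}" and ?E2 = "{(w, x). (w, x) \<in> E \<and> L < dist w x}"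
  have fin12: "finite ?E1" "finite ?E2" by (auto intro: finite_subset[OF _ fin])
  have "(\<Sum>(w, x)\<in>E. dist w x) = (\<Sum>(w, x)\<in>?E1 \<union> ?E2. dist w x)"
    by (intro sum.cong) auto
  also have "\<dots> = (\<Sum>(w, x)\<in>?E1. dist w x) + (\<Sum>(w, x)\<in>?E2. dist w x)"
    using fin12 by (intro sum.union_disjoint) auto
  also have "(\<Sum>(w, x)\<in>?E1. dist w x) \<le> 4 * real (card {1..m^2}) * (\<beta> * L / (\<beta> - 1))"
  proof (rule short_hops_le[OF \<beta> A _ fin12(1), where a = a])
    fix w x assume "(w, x) \<in> ?E1"
    then obtain i j where ij: "i \<in> {1..m^2}" "j \<in> {1..m^2}" "i \<noteq> j" "w \<in> ?S i" "x \<in> ?S j"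
      using cross[of w x] by blast
    \<comment> \<open>The interior of square \<open>i\<close> belongs to that square, so
      disjointness keeps \<open>x\<close> out of it.\<close>
    then show "\<exists>i\<in>{1..m^2}. w \<in> cbox (a i) (a i + vec L) \<and> x \<notin> box (a i) (a i + vec L)"
      using a[of i] disj[OF ij(1-3)] by blast
  qed (use E t in \<open>auto simp: L_def\<close>)
  also have "4 * real (card {1..m^2}) * (\<beta> * L / (\<beta> - 1)) = 4 * \<beta> / (\<beta> - 1) * t * real m"
    using m by (simp add: L_def power2_eq_square)
  also have "(\<Sum>(w, x)\<in>?E2. dist w x) \<le> 6 * (2 * \<beta> - 1) / (\<beta> - 1) * t * real m"
    using E box by (intro long_hops_le[OF \<beta> m t A fin12(2)]) (auto simp: L_def)
  also have "6 * (2 * \<beta> - 1) / (\<beta> - 1) * t * real m \<le> 12 * \<beta> / (\<beta> - 1) * t * real m"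
    using \<beta> t by (intro mult_right_mono divide_right_mono) auto
  finally show ?thesis by (simp add: add_divide_distrib[symmetric] distrib_right[symmetric])
qed

section \<open>Comparison of the capacities\<close>

text \<open>With the unconstrained capacity on the left and the constrained, smaller one on the
  right, this yields both versions of the theorem. The hops of a slot are split into those inside
  one square and those between squares.\<close>

lemma transport_capacity_le_sum_capacity1:
  assumes \<beta>: "\<beta> > 1" and m: "m \<ge> 1" and t: "t > 0" and X: "finite X" and Q: "square_partition m Q"
  shows "transport_capacity \<beta> (X \<inter> cbox 0 (vec t))
     \<le> (\<Sum>i=1..m^2. transport_capacity1 \<beta> (X \<inter> (\<lambda>y. t *\<^sub>R y) ` Q i))
        + ereal (16 * \<beta> / (\<beta> - 1) * t * real m)"
proof (rule transport_capacity_le)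
  let ?Y = "X \<inter> cbox 0 (vec t)" and ?Z = "\<lambda>i. X \<inter> (\<lambda>y. t *\<^sub>R y) ` Q i" and ?I = "{1..m^2}"
  fix A assume A: "valid_slot ?Y A"
  define E where "E = {(w, x). successful \<beta> A w x}"
  define B where "B i = A \<inter> ?Z i \<times> ?Z i" for i
  define R where "R = E - (\<Union>i\<in>?I. B i)"
  have EA: "E \<subseteq> A" by (simp add: E_def successful_subset)
  have finE: "finite E" unfolding E_def using finite_successful[OF _ A] X by simp
  have valB: "valid_slot (?Z i) (B i)" for i
    using A by (auto simp: valid_slot_def B_def single_valued_def)
  \<comment> \<open>Dropping the other transmitters removes interference only, so hops inside a
    square stay successful.\<close>
  have "E \<inter> B i \<subseteq> {(w, x). successful \<beta> (B i) w x}" for i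
    by (auto simp: E_def B_def successful_def)
  then have intra: "(\<Sum>(w, x)\<in>E \<inter> B i. dist w x) \<le> slot_transport \<beta> (B i)" for i
    unfolding slot_transport_def using X
    by (intro sum_mono2 finite_successful[OF _ valB]) auto
  have cover: "x \<in> cbox 0 (vec t) \<Longrightarrow> \<exists>i\<in>?I. x \<in> (\<lambda>y. t *\<^sub>R y) ` Q i" for x
  proof -
    assume "x \<in> cbox 0 (vec t)"
    then have "(1 / t) *\<^sub>R x \<in> cbox 0 (vec 1)"
      using t by (auto simp: mem_box_cart)
    then have "(1 / t) *\<^sub>R x \<in> (\<Union>i\<in>?I. Q i)" using Q by (simp add: square_partition_def)
    then obtain i where "i \<in> ?I" "(1 / t) *\<^sub>R x \<in> Q i" by blast
    then show ?thesis using t by (intro bexI[of _ i] image_eqI[of _ _ "(1 / t) *\<^sub>R x"]) auto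
  qed
  have RY: "R \<subseteq> ?Y \<times> ?Y" using EA A by (auto simp: R_def valid_slot_def)
  have "(\<Sum>(w, x)\<in>R. dist w x) \<le> 16 * \<beta> / (\<beta> - 1) * t * real m"
  proof (rule crossing_le[OF \<beta> m t Q])
    fix w x assume wx: "(w, x) \<in> R"
    then have "w \<in> ?Y" "x \<in> ?Y" using RY by auto
    then obtain i j where "i \<in> ?I" "w \<in> ?Z i" "j \<in> ?I" "x \<in> ?Z j" using cover by blast
    moreover from this have "i \<noteq> j" using wx EA by (auto simp: R_def B_def)
    ultimately show "\<exists>i\<in>?I. \<exists>j\<in>?I. i \<noteq> j \<and> w \<in> (\<lambda>y. t *\<^sub>R y) ` Q i \<and> x \<in> (\<lambda>y. t *\<^sub>R y) ` Q j"
      by blast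
  qed (use A finE RY in \<open>auto simp: valid_slot_def R_def E_def\<close>)
  moreover have "(\<Sum>(w, x)\<in>E - R. dist w x) \<le> (\<Sum>i\<in>?I. slot_transport \<beta> (B i))"
  proof -
    have "(\<Sum>(w, x)\<in>E - R. dist w x) \<le> (\<Sum>i\<in>?I. \<Sum>(w, x)\<in>E \<inter> B i. dist w x)"
      using finE by (intro sum_le_sum_cover) (auto simp: R_def)
    also have "\<dots> \<le> (\<Sum>i\<in>?I. slot_transport \<beta> (B i))" by (intro sum_mono intra)
    finally show ?thesis .
  qed
  moreover have "slot_transport \<beta> A = (\<Sum>(w, x)\<in>E - R. dist w x) + (\<Sum>(w, x)\<in>R. dist w x)"
    unfolding slot_transport_def E_def[symmetric]
    using finE by (intro sum.subset_diff) (auto simp: R_def)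
  ultimately have "ereal (slot_transport \<beta> A)
     \<le> ereal (\<Sum>i\<in>?I. slot_transport \<beta> (B i)) + ereal (16 * \<beta> / (\<beta> - 1) * t * real m)"
    by simp
  also have "ereal (\<Sum>i\<in>?I. slot_transport \<beta> (B i)) \<le> (\<Sum>i\<in>?I. transport_capacity1 \<beta> (?Z i))"
    unfolding sum_ereal[symmetric]
    using X by (intro sum_mono slot_transport_le_capacity1 valB) auto
  finally show "ereal (slot_transport \<beta> A) \<le> (\<Sum>i=1..m^2. transport_capacity1 \<beta> (?Z i))
        + ereal (16 * \<beta> / (\<beta> - 1) * t * real m)"
    by (simp add: add_right_mono)
qed (use X in simp)

lemma transport_capacity1_le: "transport_capacity1 \<beta> X \<le> transport_capacity \<beta> X"
  by (auto simp: transport_capacity1_def transport_capacity_def transport_sup_def intro!: SUP_subset_mono)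

theorem theorem1:
  fixes \<beta> :: real
  assumes "\<beta> > 1"
  shows "(\<exists>C::real. \<forall>(m::nat) (t::real) (X::(real^2) set) (Q::nat \<Rightarrow> (real^2) set).
            m \<ge> 1 \<longrightarrow> t > 0 \<longrightarrow> finite X \<longrightarrow> square_partition m Q \<longrightarrow>
            transport_capacity \<beta> (X \<inter> cbox 0 (vec t))
              \<le> (\<Sum>i=1..m^2. transport_capacity \<beta> (X \<inter> (\<lambda>y. t *\<^sub>R y) ` Q i))
                 + ereal (C * t * real m))
       \<and> (\<exists>C::real. \<forall>(m::nat) (t::real) (X::(real^2) set) (Q::nat \<Rightarrow> (real^2) set).
            m \<ge> 1 \<longrightarrow> t > 0 \<longrightarrow> finite X \<longrightarrow> square_partition m Q \<longrightarrow>
            transport_capacity1 \<beta> (X \<inter> cbox 0 (vec t))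
              \<le> (\<Sum>i=1..m^2. transport_capacity1 \<beta> (X \<inter> (\<lambda>y. t *\<^sub>R y) ` Q i))
                 + ereal (C * t * real m))"
proof (intro conjI exI[of _ "16 * \<beta> / (\<beta> - 1)"] allI impI)
  fix m :: nat and t :: real and X Q
  assume *: "m \<ge> 1" "t > 0" "finite (X :: (real^2) set)" "square_partition m Q"
  let ?Z = "\<lambda>i. X \<inter> (\<lambda>y. t *\<^sub>R y) ` Q i" and ?e = "ereal (16 * \<beta> / (\<beta> - 1) * t * real m)"
  note main = transport_capacity_le_sum_capacity1[OF assms *]
  show "transport_capacity1 \<beta> (X \<inter> cbox 0 (vec t)) \<le> (\<Sum>i=1..m^2. transport_capacity1 \<beta> (?Z i)) + ?e"
    using transport_capacity1_le main by (rule order_trans)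
  have "(\<Sum>i=1..m^2. transport_capacity1 \<beta> (?Z i)) + ?e \<le> (\<Sum>i=1..m^2. transport_capacity \<beta> (?Z i)) + ?e"
    by (intro add_right_mono sum_mono transport_capacity1_le)
  with main show "transport_capacity \<beta> (X \<inter> cbox 0 (vec t)) \<le> (\<Sum>i=1..m^2. transport_capacity \<beta> (?Z i)) + ?e"
    by (rule order_trans)
qed

end
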